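(* Let $P_0,P_1$ be probability measures on a measurable space $\mathcal Y$ with $P_1\ll P_0$ and $\rho^2:=\chi^2(P_1\Vert P_0)<\infty$. For every $\alpha\in[0,1]$, every integer $m\ge 1$, and every (possibly randomized) test, i.e. every measurable $\phi_m:\mathcal Y^m\to[0,1]$, $$a_m(\phi_m)+b_m(\phi_m,\alpha)\;\ge\;1-\min\{1,C_m(\alpha,\rho)\},\qquad C_m(\alpha,\rho):=\tfrac12\left\{(1+\alpha^2\rho^2)^m-1\right\}^{1/2}.$$ Consequently, for every $\tau\in(0,1)$, every test $\phi_m$ with $a_m(\phi_m)\le\tau$ satisfies $$\pi_m(\phi_m,\alpha)\;\le\;\min\bigl\{1,\ \tau+\min\{1,C_m(\alpha,\rho)\}\bigr\}.$$
   Context: $\chi^2(P_1\Vert P_0)=\mathbb E_{P_0}[(r-1)^2]$ with $r=\mathrm dP_1/\mathrm dP_0$. For $\alpha\in[0,1]$ put $Q_\alpha=(1-\alpha)P_0+\alpha P_1$. The $m$ observations are i.i.d.: they have joint law $P_0^{\otimes m}$ under the null $H_0:\alpha=0$ and $Q_\alpha^{\otimes m}$ under the alternative. For a test $\phi_m:\mathcal Y^m\to[0,1]$ (the value being the probability of rejecting), the type-I error is $a_m(\phi_m)=\mathbb E_{P_0^{\otimes m}}[\phi_m]$, the type-II error is $b_m(\phi_m,\alpha)=\mathbb E_{Q_\alpha^{\otimes m}}[1-\phi_m]$, and the power is $\pi_m(\phi_m,\alpha)=1-b_m(\phi_m,\alpha)$. *)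

theory Defs
  imports "HOL-Probability.Probability"
begin

(* Valued in ennreal, so that the divergence is genuinely infinite when (r - 1)^2 is not
   integrable. RN_deriv P0 P1 is dP1/dP0 and is meaningful only if P1 is absolutely continuous
   with respect to P0. *)
definition chi_square :: "'a measure \<Rightarrow> 'a measure \<Rightarrow> ennreal" where
  "chi_square P1 P0 = (\<integral>\<^sup>+ y. ennreal ((enn2real (RN_deriv P0 P1 y) - 1)\<^sup>2) \<partial>P0)"

(* Intended for sets P1 = sets P0 and 0 <= \<alpha> <= 1; the set function below is then countably
   additive, so measure_of keeps its values (see emeasure_mixture). *)
definition mixture :: "'a measure \<Rightarrow> 'a measure \<Rightarrow> real \<Rightarrow> 'a measure" where
  "mixture P0 P1 \<alpha> = measure_of (space P0) (sets P0)
     (\<lambda>A. ennreal (1 - \<alpha>) * emeasure P0 A + ennreal \<alpha> * emeasure P1 A)"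

definition iid_law :: "nat \<Rightarrow> 'a measure \<Rightarrow> (nat \<Rightarrow> 'a) measure" where
  "iid_law m P = PiM {..<m} (\<lambda>_. P)"

(* Only the sigma-algebra of M matters here. *)
definition is_test :: "'a measure \<Rightarrow> nat \<Rightarrow> ((nat \<Rightarrow> 'a) \<Rightarrow> real) \<Rightarrow> bool" where
  "is_test M m \<phi> \<longleftrightarrow> \<phi> \<in> borel_measurable (PiM {..<m} (\<lambda>_. M)) \<and>
     (\<forall>y \<in> space (PiM {..<m} (\<lambda>_. M)). 0 \<le> \<phi> y \<and> \<phi> y \<le> 1)"

definition type_I_error :: "'a measure \<Rightarrow> nat \<Rightarrow> ((nat \<Rightarrow> 'a) \<Rightarrow> real) \<Rightarrow> real" where
  "type_I_error P0 m \<phi> = (\<integral>y. \<phi> y \<partial>iid_law m P0)"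

definition type_II_error ::
  "'a measure \<Rightarrow> 'a measure \<Rightarrow> nat \<Rightarrow> ((nat \<Rightarrow> 'a) \<Rightarrow> real) \<Rightarrow> real \<Rightarrow> real" where
  "type_II_error P0 P1 m \<phi> \<alpha> = (\<integral>y. 1 - \<phi> y \<partial>iid_law m (mixture P0 P1 \<alpha>))"

definition test_power ::
  "'a measure \<Rightarrow> 'a measure \<Rightarrow> nat \<Rightarrow> ((nat \<Rightarrow> 'a) \<Rightarrow> real) \<Rightarrow> real \<Rightarrow> real" where
  "test_power P0 P1 m \<phi> \<alpha> = 1 - type_II_error P0 P1 m \<phi> \<alpha>"

definition C_bound :: "nat \<Rightarrow> real \<Rightarrow> real \<Rightarrow> real" where
  "C_bound m \<alpha> \<rho> = 1 / 2 * sqrt ((1 + \<alpha>\<^sup>2 * \<rho>\<^sup>2) ^ m - 1)"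

lemma space_mixture [simp]: "space (mixture P0 P1 \<alpha>) = space P0"
  and sets_mixture [simp, measurable_cong]: "sets (mixture P0 P1 \<alpha>) = sets P0"
  by (simp_all add: mixture_def)

lemma emeasure_mixture:
  assumes "sets P1 = sets P0" "A \<in> sets P0"
  shows "emeasure (mixture P0 P1 \<alpha>) A =
    ennreal (1 - \<alpha>) * emeasure P0 A + ennreal \<alpha> * emeasure P1 A"
proof (rule emeasure_measure_of[OF mixture_def])
  show "countably_additive (sets (mixture P0 P1 \<alpha>))
     (\<lambda>A. ennreal (1 - \<alpha>) * emeasure P0 A + ennreal \<alpha> * emeasure P1 A)"
  proof (rule countably_additiveI)
    fix F :: "nat \<Rightarrow> _" assume F: "range F \<subseteq> sets (mixture P0 P1 \<alpha>)" "disjoint_family F"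
    then have "(\<Sum>i. emeasure P0 (F i)) = emeasure P0 (\<Union>i. F i)"
      "(\<Sum>i. emeasure P1 (F i)) = emeasure P1 (\<Union>i. F i)"
      using assms(1) by (auto intro!: suminf_emeasure)
    then show "(\<Sum>i. ennreal (1 - \<alpha>) * emeasure P0 (F i) + ennreal \<alpha> * emeasure P1 (F i)) =
       ennreal (1 - \<alpha>) * emeasure P0 (\<Union>i. F i) + ennreal \<alpha> * emeasure P1 (\<Union>i. F i)"
      by (simp add: suminf_add[symmetric])
  qed
qed (use assms sets.space_closed in \<open>auto simp: positive_def\<close>)

lemma prob_space_mixture:
  assumes "prob_space P0" "prob_space P1" "sets P1 = sets P0" "0 \<le> \<alpha>" "\<alpha> \<le> 1"
  shows "prob_space (mixture P0 P1 \<alpha>)"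
proof
  have "space P1 = space P0" using assms(3) by (rule sets_eq_imp_space_eq)
  then have "emeasure P1 (space P0) = 1" using prob_space.emeasure_space_1[OF assms(2)] by simp
  then show "emeasure (mixture P0 P1 \<alpha>) (space (mixture P0 P1 \<alpha>)) = 1"
    using assms by (simp add: emeasure_mixture prob_space.emeasure_space_1 flip: ennreal_plus)
qed

end

theory Submission
  imports Defs
begin

text \<open>With \<open>L\<close> the likelihood ratio of the alternative with respect to the null, the sum of the two
  errors is \<open>1 - E (\<phi> * (L - 1))\<close>. As \<open>L - 1\<close> has mean zero, \<open>\<phi>\<close> may be replaced by \<open>\<phi> - 1/2\<close>, which
  is bounded by \<open>1/2\<close> (this is where the factor in \<open>C_bound\<close> comes from), and Cauchy-Schwarz bounds
  the loss by half the standard deviation of \<open>L\<close>. For i.i.d. observations \<open>E (L\<^sup>2)\<close> is the \<open>m\<close>-th power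
  of the single-observation second moment \<open>1 + \<alpha>\<^sup>2 * \<rho>\<^sup>2\<close>.\<close>

text \<open>Form of the bound on a single probability space. In the application \<open>M\<close> is
  the joint null law and \<open>L\<close> the density of the joint alternative, so that the second
  expectation on the right is the type-II error after a change of measure.\<close>

lemma (in prob_space) test_errors_ge_second_moment:
  fixes L \<phi> :: "'a \<Rightarrow> real"
  assumes L: "integrable M L" "integrable M (\<lambda>x. (L x)\<^sup>2)" "expectation L = 1"
    and \<phi>: "\<phi> \<in> borel_measurable M" "\<And>x. x \<in> space M \<Longrightarrow> 0 \<le> \<phi> x \<and> \<phi> x \<le> 1"
  shows "1 - 1 / 2 * sqrt (expectation (\<lambda>x. (L x)\<^sup>2) - 1)
    \<le> expectation \<phi> + expectation (\<lambda>x. L x * (1 - \<phi> x))"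
proof -
  have [measurable]: "L \<in> borel_measurable M" "\<phi> \<in> borel_measurable M" using L \<phi> by auto
  have int_\<phi>: "integrable M \<phi>"
    by (rule integrable_const_bound[of _ 1]) (use \<phi> in auto)
  have int_L1: "integrable M (\<lambda>x. L x - 1)" and int_abs: "integrable M (\<lambda>x. \<bar>L x - 1\<bar>)"
    using L(1) by auto
  have int_L\<phi>: "integrable M (\<lambda>x. L x * \<phi> x)"
    by (rule Bochner_Integration.integrable_bound[OF L(1)])
      (use \<phi>(2) in \<open>auto simp: abs_mult intro!: mult_left_le\<close>)
  have sq: "(\<lambda>x. (L x - 1)\<^sup>2) = (\<lambda>x. (L x)\<^sup>2 - 2 * L x + 1)"
    by (simp add: fun_eq_iff power2_eq_square algebra_simps)
  have int_sq: "integrable M (\<lambda>x. (L x - 1)\<^sup>2)" unfolding sq using L by auto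
  have E_sq: "expectation (\<lambda>x. (L x - 1)\<^sup>2) = expectation (\<lambda>x. (L x)\<^sup>2) - 1"
    unfolding sq using L by (simp add: prob_space)
  \<comment> \<open>The Cauchy-Schwarz step: nonnegative variance of
    \<open>\<bar>L x - 1\<bar>\<close> says that its squared mean is at most its second
    moment.\<close>
  have "0 \<le> variance (\<lambda>x. \<bar>L x - 1\<bar>)" by (rule variance_positive)
  then have "(expectation (\<lambda>x. \<bar>L x - 1\<bar>))\<^sup>2 \<le> expectation (\<lambda>x. (L x)\<^sup>2) - 1"
    using int_abs int_sq by (simp add: variance_eq E_sq)
  then have E_abs: "expectation (\<lambda>x. \<bar>L x - 1\<bar>) \<le> sqrt (expectation (\<lambda>x. (L x)\<^sup>2) - 1)"
    by (rule real_le_rsqrt)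
  \<comment> \<open>In expectation the first two terms on the right add up to 1, since
    \<open>L\<close> has mean 1; the other two are the errors.\<close>
  have eq: "(\<phi> x - 1 / 2) * (L x - 1) = L x / 2 + 1 / 2 - \<phi> x - L x * (1 - \<phi> x)" for x
    by (simp add: field_simps)
  have int_b: "integrable M (\<lambda>x. L x * (1 - \<phi> x))"
    using int_L\<phi> L(1) by (simp add: algebra_simps)
  have "1 - (expectation \<phi> + expectation (\<lambda>x. L x * (1 - \<phi> x)))
      = expectation (\<lambda>x. (\<phi> x - 1 / 2) * (L x - 1))"
    unfolding eq using int_\<phi> int_b L by (simp add: prob_space)
  also have "\<dots> \<le> expectation (\<lambda>x. 1 / 2 * \<bar>L x - 1\<bar>)"
  proof (rule integral_mono)
    show "integrable M (\<lambda>x. (\<phi> x - 1 / 2) * (L x - 1))"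
      unfolding eq using int_\<phi> int_b L by auto
    fix x assume "x \<in> space M"
    then have "\<bar>\<phi> x - 1 / 2\<bar> \<le> 1 / 2" unfolding abs_le_iff using \<phi>(2)[of x] by linarith
    then have "\<bar>(\<phi> x - 1 / 2) * (L x - 1)\<bar> \<le> 1 / 2 * \<bar>L x - 1\<bar>"
      unfolding abs_mult by (rule mult_right_mono) simp
    then show "(\<phi> x - 1 / 2) * (L x - 1) \<le> 1 / 2 * \<bar>L x - 1\<bar>" by linarith
  qed (use int_abs in auto)
  also have "\<dots> \<le> 1 / 2 * sqrt (expectation (\<lambda>x. (L x)\<^sup>2) - 1)" using E_abs by simp
  finally show ?thesis by simp
qed

text \<open>A product measure is determined by its values on boxes. The indicator of a box factors
  over the coordinates, as the density does, so Tonelli turns the integral over the box into a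
  product of one-dimensional integrals.\<close>

lemma PiM_density:
  fixes f :: "'a \<Rightarrow> real"
  assumes "prob_space M" "prob_space (density M f)" "finite I"
    and [measurable]: "f \<in> borel_measurable M" and f: "\<And>x. 0 \<le> f x"
  shows "PiM I (\<lambda>_. density M f) = density (PiM I (\<lambda>_. M)) (\<lambda>y. \<Prod>i\<in>I. f (y i))"
proof -
  interpret M: prob_space M by fact
  interpret N: prob_space "density M f" by fact
  interpret PM: product_sigma_finite "\<lambda>_. M" by unfold_locales
  interpret PN: product_sigma_finite "\<lambda>_. density M f" by unfold_locales
  have "sets (PiM I (\<lambda>_. density M f)) = sets (PiM I (\<lambda>_. M))"
    by (intro sets_PiM_cong) auto
  then show ?thesis
  proof (intro PN.PiM_eqI[symmetric])
    fix A assume A: "\<And>i. i \<in> I \<Longrightarrow> A i \<in> sets (density M f)"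
    then have [measurable]: "\<And>i. i \<in> I \<Longrightarrow> A i \<in> sets M" by simp
    have "Pi\<^sub>E I A \<in> sets (PiM I (\<lambda>_. M))" using A \<open>finite I\<close> by (intro sets_PiM_I_finite) auto
    then have "emeasure (density (PiM I (\<lambda>_. M)) (\<lambda>y. \<Prod>i\<in>I. f (y i))) (Pi\<^sub>E I A)
        = (\<integral>\<^sup>+y. ennreal (\<Prod>i\<in>I. f (y i)) * indicator (Pi\<^sub>E I A) y \<partial>PiM I (\<lambda>_. M))"
      by (intro emeasure_density) auto
    also have "\<dots> = (\<integral>\<^sup>+y. (\<Prod>i\<in>I. ennreal (f (y i)) * indicator (A i) (y i)) \<partial>PiM I (\<lambda>_. M))"
    proof (rule nn_integral_cong)
      fix y assume "y \<in> space (PiM I (\<lambda>_. M))"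
      \<comment> \<open>Points of the product space are already extensional, so lying in the box is
        a condition on the coordinates alone.\<close>
      then have "indicator (Pi\<^sub>E I A) y = (\<Prod>i\<in>I. indicator (A i) (y i) :: ennreal)"
        using \<open>finite I\<close> by (auto simp: indicator_def space_PiM PiE_def Pi_def prod_zero_iff)
      then show "ennreal (\<Prod>i\<in>I. f (y i)) * indicator (Pi\<^sub>E I A) y
          = (\<Prod>i\<in>I. ennreal (f (y i)) * indicator (A i) (y i))"
        using f by (simp add: prod.distrib prod_ennreal)
    qed
    also have "\<dots> = (\<Prod>i\<in>I. \<integral>\<^sup>+x. ennreal (f x) * indicator (A i) x \<partial>M)"
      using \<open>finite I\<close> by (intro PM.product_nn_integral_prod) auto
    also have "\<dots> = (\<Prod>i\<in>I. emeasure (density M f) (A i))"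
      by (intro prod.cong refl emeasure_density[symmetric]) auto
    finally show "emeasure (density (PiM I (\<lambda>_. M)) (\<lambda>y. \<Prod>i\<in>I. f (y i))) (Pi\<^sub>E I A)
        = (\<Prod>i\<in>I. emeasure (density M f) (A i))" .
  qed (use \<open>finite I\<close> in \<open>auto\<close>)
qed

text \<open>Passes from the \<open>ennreal\<close>-valued derivative to a real density with Bochner
  moments. Finite divergence makes \<open>(r x - 1)\<^sup>2\<close> integrable, and mean 1 turns the
  centred second moment into the raw one.\<close>

lemma chi_square_finite_density:
  assumes "prob_space P0" "prob_space P1" "sets P1 = sets P0" "absolutely_continuous P0 P1"
    and fin: "chi_square P1 P0 < \<infinity>"
  obtains r :: "'a \<Rightarrow> real" where "r \<in> borel_measurable P0" "\<And>x. 0 \<le> r x" "density P0 r = P1"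
    "integrable P0 r" "integral\<^sup>L P0 r = 1" "integrable P0 (\<lambda>x. (r x)\<^sup>2)"
    "integral\<^sup>L P0 (\<lambda>x. (r x)\<^sup>2) = 1 + enn2real (chi_square P1 P0)"
proof -
  interpret P0: prob_space P0 by fact
  interpret P1: prob_space P1 by fact
  define r where "r x = enn2real (RN_deriv P0 P1 x)" for x
  have r[measurable]: "r \<in> borel_measurable P0" unfolding r_def by measurable
  have r0: "0 \<le> r x" for x by (simp add: r_def)
  \<comment> \<open>\<open>enn2real\<close> sends infinity to 0, so \<open>r\<close> could differ
    from the derivative where the latter is infinite; that set is null.\<close>
  have "AE x in P0. RN_deriv P0 P1 x \<noteq> \<infinity>"
    using assms by (intro P0.RN_deriv_finite P1.sigma_finite_measure_axioms) auto
  then have "density P0 r = density P0 (RN_deriv P0 P1)"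
    by (intro density_cong) (auto simp: r_def less_top)
  also have "\<dots> = P1" using assms by (intro P0.density_RN_deriv) auto
  finally have dens: "density P0 r = P1" .
  have "(\<integral>\<^sup>+x. r x \<partial>P0) = emeasure (density P0 r) (space P0)"
    by (subst emeasure_density) (auto intro!: nn_integral_cong)
  also have "\<dots> = 1"
    using P1.emeasure_space_1 sets_eq_imp_space_eq[OF assms(3)] by (simp add: dens)
  finally have nn: "(\<integral>\<^sup>+x. r x \<partial>P0) = 1" .
  have int_r: "integrable P0 r" by (rule integrableI_nonneg) (auto simp: r0 nn)
  have E_r: "integral\<^sup>L P0 r = 1" by (subst integral_eq_nn_integral) (auto simp: r0 nn)
  have chi: "chi_square P1 P0 = (\<integral>\<^sup>+x. (r x - 1)\<^sup>2 \<partial>P0)" by (simp add: chi_square_def r_def)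
  have int_sq: "integrable P0 (\<lambda>x. (r x - 1)\<^sup>2)"
    by (rule integrableI_nonneg) (use fin in \<open>auto simp: chi\<close>)
  have E_sq: "integral\<^sup>L P0 (\<lambda>x. (r x - 1)\<^sup>2) = enn2real (chi_square P1 P0)"
    by (subst integral_eq_nn_integral) (auto simp: chi)
  have sq: "(\<lambda>x. (r x)\<^sup>2) = (\<lambda>x. (r x - 1)\<^sup>2 + (2 * r x - 1))"
    by (simp add: fun_eq_iff power2_eq_square algebra_simps)
  show thesis
  proof (rule that[OF r r0 dens int_r E_r])
    show "integrable P0 (\<lambda>x. (r x)\<^sup>2)" unfolding sq using int_sq int_r by auto
    show "integral\<^sup>L P0 (\<lambda>x. (r x)\<^sup>2) = 1 + enn2real (chi_square P1 P0)"
      unfolding sq using int_sq int_r by (simp add: E_r E_sq P0.prob_space)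
  qed
qed

lemma mixture_eq_density:
  fixes r :: "'a \<Rightarrow> real"
  assumes [measurable]: "r \<in> borel_measurable P0" and r: "\<And>x. 0 \<le> r x"
    and \<alpha>: "0 \<le> \<alpha>" "\<alpha> \<le> 1"
  shows "mixture P0 (density P0 r) \<alpha> = density P0 (\<lambda>x. 1 - \<alpha> + \<alpha> * r x)"
proof (rule measure_eqI)
  fix A assume "A \<in> sets (mixture P0 (density P0 r) \<alpha>)"
  then have [measurable]: "A \<in> sets P0" by simp
  have "emeasure (density P0 (\<lambda>x. 1 - \<alpha> + \<alpha> * r x)) A
      = (\<integral>\<^sup>+x. ennreal (1 - \<alpha> + \<alpha> * r x) * indicator A x \<partial>P0)"
    by (rule emeasure_density) auto
  \<comment> \<open>\<open>ennreal\<close> truncates negative reals to 0; it splits over this sum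
    and product because both weights and \<open>r\<close> are nonnegative.\<close>
  also have "\<dots> = (\<integral>\<^sup>+x. ennreal (1 - \<alpha>) * indicator A x + ennreal \<alpha> * (ennreal (r x) * indicator A x) \<partial>P0)"
    using \<alpha> r by (intro nn_integral_cong) (simp add: ennreal_mult distrib_right mult.assoc)
  also have "\<dots> = ennreal (1 - \<alpha>) * emeasure P0 A + ennreal \<alpha> * emeasure (density P0 r) A"
    by (simp add: nn_integral_add nn_integral_cmult emeasure_density)
  finally show "emeasure (mixture P0 (density P0 r) \<alpha>) A
      = emeasure (density P0 (\<lambda>x. 1 - \<alpha> + \<alpha> * r x)) A"
    by (simp add: emeasure_mixture)
qed simp

text \<open>Here \<open>f\<close> is the likelihood ratio of one observation and \<open>L\<close>
  that of the whole sample; the abstract bound is applied to \<open>L\<close> under the joint null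
  law.\<close>

lemma type_errors_ge:
  assumes "prob_space P0" "prob_space P1" "sets P1 = sets P0" "absolutely_continuous P0 P1"
    "chi_square P1 P0 < \<infinity>" and \<rho>: "\<rho>\<^sup>2 = enn2real (chi_square P1 P0)"
    and \<alpha>: "0 \<le> \<alpha>" "\<alpha> \<le> 1" and test: "is_test P0 m \<phi>"
  shows "1 - min 1 (C_bound m \<alpha> \<rho>) \<le> type_I_error P0 m \<phi> + type_II_error P0 P1 m \<phi> \<alpha>"
proof -
  obtain r where r[measurable]: "r \<in> borel_measurable P0" and r0: "\<And>x. 0 \<le> r x"
    and dens: "density P0 r = P1" and int_r: "integrable P0 r" "integrable P0 (\<lambda>x. (r x)\<^sup>2)"
    and E_r: "integral\<^sup>L P0 r = 1"
      "integral\<^sup>L P0 (\<lambda>x. (r x)\<^sup>2) = 1 + enn2real (chi_square P1 P0)"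
    using chi_square_finite_density[OF assms(1-5)] by metis
  interpret P0: prob_space P0 by fact
  interpret prod: product_sigma_finite "\<lambda>_. P0" by unfold_locales
  interpret law: prob_space "iid_law m P0"
    unfolding iid_law_def by (intro prob_space_PiM assms)
  define f where "f x = 1 - \<alpha> + \<alpha> * r x" for x
  define L where "L y = (\<Prod>i<m. f (y i))" for y :: "nat \<Rightarrow> 'a"
  have f[measurable]: "f \<in> borel_measurable P0" unfolding f_def by measurable
  have f0: "0 \<le> f x" for x using \<alpha> r0 by (simp add: f_def)
  have L[measurable]: "L \<in> borel_measurable (iid_law m P0)" unfolding L_def iid_law_def by measurable
  have mix: "mixture P0 P1 \<alpha> = density P0 f"
    using mixture_eq_density[OF r r0 \<alpha>] by (simp add: dens f_def)
  have "prob_space (density P0 f)"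
    using prob_space_mixture[OF assms(1-3) \<alpha>] by (simp add: mix)
  then have law_mix: "iid_law m (mixture P0 P1 \<alpha>) = density (iid_law m P0) L"
    unfolding mix iid_law_def L_def using assms(1) f0 by (intro PiM_density) auto
  have int_f: "integrable P0 f" unfolding f_def using int_r by auto
  have E_f: "integral\<^sup>L P0 f = 1" unfolding f_def using int_r by (simp add: E_r P0.prob_space)
  have f_sq: "(\<lambda>x. (f x)\<^sup>2) = (\<lambda>x. (1 - \<alpha>)\<^sup>2 + 2 * (1 - \<alpha>) * \<alpha> * r x + \<alpha>\<^sup>2 * (r x)\<^sup>2)"
    by (simp add: f_def fun_eq_iff power2_eq_square algebra_simps)
  have int_f_sq: "integrable P0 (\<lambda>x. (f x)\<^sup>2)" unfolding f_sq using int_r by auto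
  \<comment> \<open>Without the \<rho> term the right-hand side is the square of (1 - \<alpha>) +
    \<alpha>, that is 1.\<close>
  have "integral\<^sup>L P0 (\<lambda>x. (f x)\<^sup>2) = (1 - \<alpha>)\<^sup>2 + 2 * (1 - \<alpha>) * \<alpha> + \<alpha>\<^sup>2 * (1 + \<rho>\<^sup>2)"
    unfolding f_sq using int_r by (simp add: E_r \<rho> P0.prob_space)
  then have E_f_sq: "integral\<^sup>L P0 (\<lambda>x. (f x)\<^sup>2) = 1 + \<alpha>\<^sup>2 * \<rho>\<^sup>2"
    by (simp add: power2_eq_square algebra_simps)
  \<comment> \<open>Squaring preserves the product form, so Fubini makes the second moment of
    \<open>L\<close> the \<open>m\<close>-th power of that of \<open>f\<close>.\<close>
  have L_sq: "(\<lambda>y. (L y)\<^sup>2) = (\<lambda>y. \<Prod>i<m. (f (y i))\<^sup>2)" by (simp add: L_def prod_power_distrib)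
  have int_L: "integrable (iid_law m P0) L" "integrable (iid_law m P0) (\<lambda>y. (L y)\<^sup>2)"
    unfolding L_sq unfolding L_def iid_law_def
    by (intro prod.product_integrable_prod; use int_f int_f_sq in auto)+
  have E_L: "law.expectation L = 1"
    unfolding L_def iid_law_def by (subst prod.product_integral_prod) (auto simp: int_f E_f)
  have E_L_sq: "law.expectation (\<lambda>y. (L y)\<^sup>2) = (1 + \<alpha>\<^sup>2 * \<rho>\<^sup>2) ^ m"
    unfolding L_sq iid_law_def
    by (subst prod.product_integral_prod) (auto simp: int_f_sq E_f_sq)
  have \<phi>[measurable]: "\<phi> \<in> borel_measurable (iid_law m P0)"
    and \<phi>01: "\<And>y. y \<in> space (iid_law m P0) \<Longrightarrow> 0 \<le> \<phi> y \<and> \<phi> y \<le> 1"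
    using test by (auto simp: is_test_def iid_law_def)
  have type_II: "type_II_error P0 P1 m \<phi> \<alpha> = law.expectation (\<lambda>y. L y * (1 - \<phi> y))"
    unfolding type_II_error_def law_mix
    by (subst integral_density) (auto simp: L_def f0 intro!: prod_nonneg)
  have "1 - C_bound m \<alpha> \<rho> \<le> type_I_error P0 m \<phi> + type_II_error P0 P1 m \<phi> \<alpha>"
    using law.test_errors_ge_second_moment[OF int_L E_L \<phi> \<phi>01]
    by (simp add: type_II type_I_error_def C_bound_def E_L_sq)
  \<comment> \<open>This covers the case where \<open>C_bound\<close> exceeds 1 and the claimed
    lower bound is 0.\<close>
  moreover have "0 \<le> type_I_error P0 m \<phi>" "0 \<le> type_II_error P0 P1 m \<phi> \<alpha>"
    unfolding type_II type_I_error_def using \<phi>01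
    by (auto simp: L_def f0 intro!: integral_nonneg_AE AE_I2 mult_nonneg_nonneg prod_nonneg)
  ultimately show ?thesis by (simp add: min_def)
qed

theorem theorem3:
  fixes P0 P1 :: "'a measure" and \<rho> :: real
  assumes "prob_space P0" and "prob_space P1" and "sets P1 = sets P0"
    and "absolutely_continuous P0 P1"
    and "chi_square P1 P0 < \<infinity>"
    and "\<rho>\<^sup>2 = enn2real (chi_square P1 P0)"
  shows "\<forall>\<alpha>\<in>{0..1}. \<forall>m\<ge>1.
    (\<forall>\<phi>. is_test P0 m \<phi> \<longrightarrow>
       type_I_error P0 m \<phi> + type_II_error P0 P1 m \<phi> \<alpha> \<ge> 1 - min 1 (C_bound m \<alpha> \<rho>)) \<and>
    (\<forall>\<tau>\<in>{0<..<1}. \<forall>\<phi>. is_test P0 m \<phi> \<and> type_I_error P0 m \<phi> \<le> \<tau> \<longrightarrow>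
       test_power P0 P1 m \<phi> \<alpha> \<le> min 1 (\<tau> + min 1 (C_bound m \<alpha> \<rho>)))"
proof (intro ballI allI impI conjI)
  fix \<alpha> :: real and m \<phi> assume "\<alpha> \<in> {0..1}" "is_test P0 m \<phi>"
  then show "type_I_error P0 m \<phi> + type_II_error P0 P1 m \<phi> \<alpha> \<ge> 1 - min 1 (C_bound m \<alpha> \<rho>)"
    using type_errors_ge[OF assms] by simp
next
  fix \<alpha> \<tau> :: real and m \<phi>
  assume \<alpha>: "\<alpha> \<in> {0..1}" and "is_test P0 m \<phi> \<and> type_I_error P0 m \<phi> \<le> \<tau>"
  then have test: "is_test P0 m \<phi>" and le: "type_I_error P0 m \<phi> \<le> \<tau>" by auto
  \<comment> \<open>\<open>is_test\<close> bounds \<phi> on the product space of \<open>P0\<close>,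
    while the type-II error integrates over that of the mixture.\<close>
  have "space (iid_law m (mixture P0 P1 \<alpha>)) = space (PiM {..<m} (\<lambda>_. P0))"
    by (simp add: iid_law_def space_PiM)
  then have "0 \<le> type_II_error P0 P1 m \<phi> \<alpha>"
    unfolding type_II_error_def using test
    by (auto simp: is_test_def intro!: integral_nonneg_AE AE_I2)
  \<comment> \<open>The cap 1 comes from the nonnegative type-II error; the other bound rearranges
    the inequality for the sum of errors, with the type-I error at most \<tau>.\<close>
  then show "test_power P0 P1 m \<phi> \<alpha> \<le> min 1 (\<tau> + min 1 (C_bound m \<alpha> \<rho>))"
    using type_errors_ge[OF assms _ _ test, of \<alpha>] \<alpha> le by (simp add: test_power_def)
qed

end
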